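(* Under unilateral link formation, the price of anarchy with a smart adversary is $O(1)$: there is an absolute constant $c>0$ such that for all integers $n\ge 3$, all $\alpha>0$, and every Nash equilibrium $S$ for $n$ players and link cost $\alpha$ with the smart adversary, $C(S)\le c\cdot \mathrm{OPT}(n,\alpha)$.
   Context: Players are $V=\{1,\dots,n\}$ ($n\ge 3$), link cost is $\alpha>0$. A strategy profile is a matrix $S\in\{0,1\}^{n\times n}$ with $S_{vv}=0$; for $v\ne w$, $S_{vw}=1$ means that player $v$ requests the edge $\{v,w\}$. Unilateral link formation: the final graph is the simple undirected graph $G(S)=(V,E(S))$ with $E(S)=\{\{v,w\}: S_{vw}=1 \text{ or } S_{wv}=1\}$. Only essential profiles are considered ($S_{vw}=1\Rightarrow S_{wv}=0$). For a connected graph $G=(V,E)$, $e\in E$, $v\in V$, the relevance $\mathrm{rel}_G(e,v)$ is the number of vertices that, starting at $v$, can only be reached via $e$ (so it is $0$ iff $e$ is not a bridge). The separation $\mathrm{sep}(e)=\sum_{v\in V}\mathrm{rel}_G(e,v)$ is the number of ordered vertex pairs separated by removing $e$. Let $\mathrm{sep}_{\max}=\max_{e\in E}\mathrm{sep}(e)$ and $E_{\max}=\{e\in E:\mathrm{sep}(e)=\mathrm{sep}_{\max}\}$. The smart adversary removes one edge chosen uniformly at random from $E_{\max}$; so the disconnection cost of $v$ is $I_v(G)=\frac{1}{|E_{\max}|}\sum_{e\in E_{\max}}\mathrm{rel}_G(e,v)$ if $G$ is connected and $I_v(G)=\infty$ otherwise. Individual cost: $C_v(S)=\alpha\sum_{w}S_{vw}+I_v(G(S))$.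 Social cost: $C(S)=\sum_{v\in V}C_v(S)$. $\mathrm{OPT}(n,\alpha)$ is the minimum of $C(S)$ over all strategy profiles. $S$ is a Nash equilibrium if no player $v$ can strictly decrease $C_v$ by changing her own row $S_v$ (arbitrarily) while the other rows stay fixed. The price of anarchy is the maximum of $C(S)/\mathrm{OPT}(n,\alpha)$ over Nash equilibria $S$. *)

theory Defs
  imports Complex_Main "HOL-Library.Extended_Real"
begin

section \<open>Walks, relevance and separation\<close>

text \<open>A simple undirected graph is given by a vertex set \<open>V\<close> and a set \<open>E\<close> of two-element
  subsets of \<open>V\<close>. A walk is recorded by the list of edges it traverses.\<close>

inductive walk :: "'a set set \<Rightarrow> 'a \<Rightarrow> 'a set list \<Rightarrow> 'a \<Rightarrow> bool" for E where
  walk_Nil: "walk E v [] v"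
| walk_Cons: "{u, v} \<in> E \<Longrightarrow> walk E v es w \<Longrightarrow> walk E u ({u, v} # es) w"

definition connected_graph :: "'a set \<Rightarrow> 'a set set \<Rightarrow> bool" where
  "connected_graph V E \<longleftrightarrow> (\<forall>v\<in>V. \<forall>w\<in>V. \<exists>es. walk E v es w)"

definition relevance :: "'a set \<Rightarrow> 'a set set \<Rightarrow> 'a set \<Rightarrow> 'a \<Rightarrow> nat" where
  "relevance V E e v = card {w \<in> V. \<forall>es. walk E v es w \<longrightarrow> e \<in> set es}"

definition separation :: "'a set \<Rightarrow> 'a set set \<Rightarrow> 'a set \<Rightarrow> nat" where
  "separation V E e = (\<Sum>v\<in>V. relevance V E e v)"

definition max_separation :: "'a set \<Rightarrow> 'a set set \<Rightarrow> nat" where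
  "max_separation V E = Max (separation V E ` E)"

definition max_sep_edges :: "'a set \<Rightarrow> 'a set set \<Rightarrow> 'a set set" where
  "max_sep_edges V E = {e \<in> E. separation V E e = max_separation V E}"

definition disconnection_cost :: "'a set \<Rightarrow> 'a set set \<Rightarrow> 'a \<Rightarrow> ereal" where
  "disconnection_cost V E v =
    (if connected_graph V E
     then ereal (1 / real (card (max_sep_edges V E)) *
                 (\<Sum>e\<in>max_sep_edges V E. real (relevance V E e v)))
     else \<infinity>)"

section \<open>The network formation game\<close>

definition players :: "nat \<Rightarrow> nat set" where
  "players n = {1..n}"

text \<open>An \<open>n \<times> n\<close> matrix is a function on all pairs of natural numbers; the entries whose index
  is not a pair of players are required to vanish, so that there are only finitely many profiles.\<close>

definition strategy_profile :: "nat \<Rightarrow> (nat \<Rightarrow> nat \<Rightarrow> nat) \<Rightarrow> bool" where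
  "strategy_profile n S \<longleftrightarrow>
    (\<forall>v w. S v w \<in> {0, 1}) \<and>
    (\<forall>v. S v v = 0) \<and>
    (\<forall>v w. v \<notin> players n \<or> w \<notin> players n \<longrightarrow> S v w = 0)"

definition essential :: "nat \<Rightarrow> (nat \<Rightarrow> nat \<Rightarrow> nat) \<Rightarrow> bool" where
  "essential n S \<longleftrightarrow> (\<forall>v\<in>players n. \<forall>w\<in>players n. S v w = 1 \<longrightarrow> S w v = 0)"

definition final_edges :: "nat \<Rightarrow> (nat \<Rightarrow> nat \<Rightarrow> nat) \<Rightarrow> nat set set" where
  "final_edges n S = {{v, w} | v w. v \<in> players n \<and> w \<in> players n \<and> (S v w = 1 \<or> S w v = 1)}"

definition individual_cost :: "nat \<Rightarrow> real \<Rightarrow> (nat \<Rightarrow> nat \<Rightarrow> nat) \<Rightarrow> nat \<Rightarrow> ereal" where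
  "individual_cost n \<alpha> S v =
    ereal (\<alpha> * (\<Sum>w\<in>players n. real (S v w))) + disconnection_cost (players n) (final_edges n S) v"

definition social_cost :: "nat \<Rightarrow> real \<Rightarrow> (nat \<Rightarrow> nat \<Rightarrow> nat) \<Rightarrow> ereal" where
  "social_cost n \<alpha> S = (\<Sum>v\<in>players n. individual_cost n \<alpha> S v)"

definition OPT :: "nat \<Rightarrow> real \<Rightarrow> ereal" where
  "OPT n \<alpha> = Min (social_cost n \<alpha> ` {S. strategy_profile n S})"

text \<open>The minimum above is over a finite nonempty set.\<close>

lemma finite_strategy_profiles: "finite {S. strategy_profile n S}"
proof (rule finite_subset)
  show "{S. strategy_profile n S} \<subseteq>
    (\<lambda>A v w. if (v, w) \<in> A then 1 else 0) ` Pow (players n \<times> players n)"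
  proof
    fix S assume "S \<in> {S. strategy_profile n S}"
    then have S: "strategy_profile n S" by simp
    let ?A = "{(v, w). S v w = 1}"
    have "S = (\<lambda>v w. if (v, w) \<in> ?A then 1 else 0)"
      using S unfolding strategy_profile_def by (auto simp: fun_eq_iff)
    moreover have "?A \<in> Pow (players n \<times> players n)"
    proof -
      have "v \<in> players n \<and> w \<in> players n" if "S v w = 1" for v w
        using S that unfolding strategy_profile_def by (metis zero_neq_one)
      then show ?thesis by auto
    qed
    ultimately show "S \<in> (\<lambda>A v w. if (v, w) \<in> A then 1 else 0) ` Pow (players n \<times> players n)"
      by (rule image_eqI)
  qed
  show "finite ((\<lambda>A v w. if (v, w) \<in> A then 1 else 0 :: nat) ` Pow (players n \<times> players n))"
    by (simp add: players_def)
qed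

lemma strategy_profiles_nonempty: "{S. strategy_profile n S} \<noteq> {}"
  by (auto simp: strategy_profile_def intro!: exI[of _ "\<lambda>_ _. 0"])

text \<open>A deviation replaces one row arbitrarily; the resulting profile need not be essential.\<close>

definition nash_equilibrium :: "nat \<Rightarrow> real \<Rightarrow> (nat \<Rightarrow> nat \<Rightarrow> nat) \<Rightarrow> bool" where
  "nash_equilibrium n \<alpha> S \<longleftrightarrow>
    strategy_profile n S \<and>
    (\<forall>v\<in>players n. \<forall>r. strategy_profile n (S(v := r)) \<longrightarrow>
       \<not> individual_cost n \<alpha> (S(v := r)) v < individual_cost n \<alpha> S v)"

end

(* A bridge is recorded by a side: a vertex set X whose edge cut is exactly that bridge. In a connected
graph relevance and separation depend only on the sizes of sides, and any two sides are laminar.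

Social cost. The disconnection costs of all players add up to the maximal separation, so an essential
profile costs \<alpha> |E| + sep_max, while every profile costs at least \<alpha> n / 2, since every player has
a link.

Number of links. Choose F1 \<subseteq> E and F2 \<subseteq> E - F1 with at most n edges each that meet every nonempty
cut of E and of E - F1, respectively. An edge outside F1 \<union> F2 is never in a cut of size at most two,
so selling it changes no relevance; hence |E| \<le> 2n in equilibrium.

Maximal separation. Write sep_max = 2k(n - k) with k the size of the smaller side A of a critical
bridge. The small sides of the critical bridges are disjoint, so players in A have disconnection cost
at least 2k(n - k)/n. If 3k \<le> n, the end point in A of the bridge can lower her cost to k by linking
across the bridge. If 3k > n, the bridges both of whose sides exceed n/3 lie on a path, and linking the
ends of this path leaves only bridges with a side of size at most n/3. Either deviation costs \<alpha>, so
k n = O(\<alpha> n). *)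

theory Submission
  imports Defs
begin

section \<open>Edge cuts and sides of bridges\<close>

lemma walk_append: "walk E u es v \<Longrightarrow> walk E v fs w \<Longrightarrow> walk E u (es @ fs) w"
  by (induction rule: walk.induct) (auto intro: walk.intros)

lemma walk_snoc: "walk E u es v \<Longrightarrow> {v, w} \<in> E \<Longrightarrow> walk E u (es @ [{v, w}]) w"
  by (rule walk_append) (auto intro: walk.intros)

text \<open>Phrased without a vertex set, so that the same \<open>X\<close> can be cut in a graph
  and in its subgraphs. For two-element edges it says that exactly one end lies in
  \<open>X\<close>.\<close>

definition edge_cut :: "'a set set \<Rightarrow> 'a set \<Rightarrow> 'a set set" where
  "edge_cut E X = {e \<in> E. e \<inter> X \<noteq> {} \<and> \<not> e \<subseteq> X}"

lemma edge_cut_mono: "F \<subseteq> E \<Longrightarrow> edge_cut F X \<subseteq> edge_cut E X"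
  by (auto simp: edge_cut_def)

text \<open>Membership in a Boolean combination of \<open>X\<close> and \<open>Y\<close> can change
  along an edge only if membership in \<open>X\<close> or in \<open>Y\<close> does.\<close>

lemma edge_cut_corners:
  "edge_cut E (X \<inter> Y) \<subseteq> edge_cut E X \<union> edge_cut E Y"
  "edge_cut E (X \<union> Y) \<subseteq> edge_cut E X \<union> edge_cut E Y"
  "edge_cut E (X - Y) \<subseteq> edge_cut E X \<union> edge_cut E Y"
  by (auto simp: edge_cut_def)

lemma walk_leaves_cut:
  "walk E v es w \<Longrightarrow> v \<in> X \<Longrightarrow> w \<notin> X \<Longrightarrow> \<exists>e\<in>edge_cut E X. e \<in> set es"
proof (induction rule: walk.induct)
  case (walk_Cons u v es w)
  then show ?case by (cases "v \<in> X") (auto simp: edge_cut_def)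
qed simp

locale finite_graph =
  fixes V :: "'a set" and E :: "'a set set"
  assumes finite_V: "finite V"
    and edges: "\<And>e. e \<in> E \<Longrightarrow> e \<subseteq> V \<and> card e = 2"
begin

lemma finite_E: "finite E"
  using finite_V edges by (intro finite_subset[of E "Pow V"]) auto

lemma edgeE:
  assumes "e \<in> E"
  obtains x y where "e = {x, y}" "x \<noteq> y" "x \<in> V" "y \<in> V"
  using edges[OF assms] by (auto simp: card_2_iff)

lemma edge_cutE:
  assumes "e \<in> edge_cut E X"
  obtains x y where "e = {x, y}" "x \<in> X" "y \<notin> X" "x \<in> V" "y \<in> V" "e \<in> E"
proof -
  have "e \<in> E" using assms by (simp add: edge_cut_def)
  with edgeE obtain x y where e: "e = {x, y}" "x \<in> V" "y \<in> V" by blast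
  then have "x \<in> X \<and> y \<notin> X \<or> y \<in> X \<and> x \<notin> X" using assms by (auto simp: edge_cut_def)
  with e \<open>e \<in> E\<close> that[of x y] that[of y x] show thesis by (auto simp: insert_commute)
qed

lemma edge_cut_Diff: "edge_cut E (V - X) = edge_cut E X"
  using edges by (fastforce simp: edge_cut_def)

lemma subgraph: "F \<subseteq> E \<Longrightarrow> finite_graph V F"
  using finite_V edges by unfold_locales auto

text \<open>Complement in \<open>V\<close> of the set that \<open>relevance\<close> counts. Here
  \<open>g\<close> may be any set, not only an edge.\<close>

definition reach :: "'a set \<Rightarrow> 'a \<Rightarrow> 'a set" where
  "reach g v = {w \<in> V. \<exists>es. walk E v es w \<and> g \<notin> set es}"

lemma relevance_reach: "relevance V E g v = card (V - reach g v)"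
proof -
  have "{w \<in> V. \<forall>es. walk E v es w \<longrightarrow> g \<in> set es} = V - reach g v"
    by (auto simp: reach_def)
  then show ?thesis by (simp add: relevance_def)
qed

lemma reach_subset: "reach g v \<subseteq> V" by (auto simp: reach_def)

lemma self_in_reach: "v \<in> V \<Longrightarrow> v \<in> reach g v"
  by (auto simp: reach_def intro: exI[of _ "[]"] walk.intros)

text \<open>Any other edge leaving the set would prolong a walk that avoids \<open>g\<close>, and
  its outer end would be reached as well.\<close>

lemma edge_cut_reach: "edge_cut E (reach g v) \<subseteq> {g}"
proof
  fix e assume "e \<in> edge_cut E (reach g v)"
  then obtain x y where xy: "e = {x, y}" "x \<in> reach g v" "y \<notin> reach g v" "y \<in> V" "e \<in> E"
    by (rule edge_cutE)
  then obtain es where es: "walk E v es x" "g \<notin> set es" by (auto simp: reach_def)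
  have "walk E v (es @ [e]) y" using walk_snoc[OF es(1)] xy by blast
  then have "g \<in> set (es @ [e])" using xy(3,4) unfolding reach_def by blast
  with es show "e \<in> {g}" by auto
qed

lemma reach_subset_side:
  assumes "edge_cut E X \<subseteq> {g}" "v \<in> X"
  shows "reach g v \<subseteq> X"
  using walk_leaves_cut[OF _ assms(2)] assms(1) unfolding reach_def by blast

text \<open>Translates connectivity from walks to cuts, so that later arguments can work with sets
  of vertices only.\<close>

lemma connected_graph_iff_cut:
  "connected_graph V E \<longleftrightarrow> (\<forall>X\<subseteq>V. X \<noteq> {} \<longrightarrow> X \<noteq> V \<longrightarrow> edge_cut E X \<noteq> {})"
proof
  assume c: "connected_graph V E"
  show "\<forall>X\<subseteq>V. X \<noteq> {} \<longrightarrow> X \<noteq> V \<longrightarrow> edge_cut E X \<noteq> {}"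
  proof (intro allI impI)
    fix X assume "X \<subseteq> V" "X \<noteq> {}" "X \<noteq> V"
    then obtain x y where "x \<in> X" "y \<in> V" "y \<notin> X" "x \<in> V" by auto
    then show "edge_cut E X \<noteq> {}"
      using c walk_leaves_cut[of E x _ y X] unfolding connected_graph_def by blast
  qed
next
  assume h: "\<forall>X\<subseteq>V. X \<noteq> {} \<longrightarrow> X \<noteq> V \<longrightarrow> edge_cut E X \<noteq> {}"
  show "connected_graph V E" unfolding connected_graph_def
  proof (intro ballI)
    fix v w assume vw: "v \<in> V" "w \<in> V"
    \<comment> \<open>The empty set is never an edge, so \<open>reach {} v\<close> consists of all
      vertices reachable from \<open>v\<close>.\<close>
    have "{} \<notin> E" using edges by fastforce
    moreover have "edge_cut E (reach {} v) \<subseteq> E" by (auto simp: edge_cut_def)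
    ultimately have "edge_cut E (reach {} v) = {}" using edge_cut_reach[of "{}" v] by blast
    moreover have "reach {} v \<noteq> {}" using self_in_reach[OF vw(1)] by auto
    ultimately have "reach {} v = V" using h reach_subset by metis
    then show "\<exists>es. walk E v es w" using vw by (auto simp: reach_def)
  qed
qed

end

section \<open>Bridges of a connected graph and their sides\<close>

locale conn_graph = finite_graph +
  assumes conn: "connected_graph V E"
begin

lemma cut_nonempty: "X \<subseteq> V \<Longrightarrow> X \<noteq> {} \<Longrightarrow> X \<noteq> V \<Longrightarrow> edge_cut E X \<noteq> {}"
  using conn connected_graph_iff_cut by blast

text \<open>One of the two components left by deleting the bridge \<open>g\<close>. An edge has a
  side exactly if it is a bridge.\<close>

definition side :: "'a set \<Rightarrow> 'a set \<Rightarrow> bool" where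
  "side g X \<longleftrightarrow> X \<subseteq> V \<and> edge_cut E X = {g}"

lemma sideD:
  assumes "side g X"
  shows "X \<subseteq> V" "edge_cut E X = {g}" "g \<in> E" "X \<noteq> {}" "X \<noteq> V"
proof -
  show X: "X \<subseteq> V" "edge_cut E X = {g}" using assms by (simp_all add: side_def)
  then have "g \<in> edge_cut E X" by simp
  then show "g \<in> E" "X \<noteq> {}" "X \<noteq> V" using edges[of g] by (auto simp: edge_cut_def)
qed

lemma side_Diff: "side g X \<Longrightarrow> side g (V - X)"
  by (simp add: side_def edge_cut_Diff)

lemma side_edgeE:
  assumes "side g X"
  obtains u v where "g = {u, v}" "v \<in> X" "u \<in> V - X"
proof -
  have "g \<in> edge_cut E X" using sideD(2)[OF assms] by simp
  then obtain x y where "g = {x, y}" "x \<in> X" "y \<notin> X" "y \<in> V" by (rule edge_cutE)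
  then show thesis using that[of y x] by (simp add: insert_commute)
qed

text \<open>The sets \<open>X \<inter> Y\<close>, \<open>X - Y\<close> and \<open>Y - X\<close> have
  no cut edge except possibly \<open>g\<close>. Whichever of them \<open>g\<close> does not cross is
  empty or all of \<open>V\<close>, by connectivity.\<close>

lemma side_unique:
  assumes X: "side g X" and Y: "side g Y" and v: "v \<in> X" "v \<in> Y"
  shows "X = Y"
proof -
  obtain a b where ab: "g = {b, a}" "a \<in> X" "b \<in> V - X" using side_edgeE[OF X] .
  have g: "g \<in> edge_cut E Y" using sideD(2)[OF Y] by simp
  have sub: "edge_cut E (X \<inter> Y) \<subseteq> {g}" "edge_cut E (X - Y) \<subseteq> {g}" "edge_cut E (Y - X) \<subseteq> {g}"
    using edge_cut_corners[of E X Y] edge_cut_corners[of E Y X] sideD(2)[OF X] sideD(2)[OF Y] by auto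
  have XV: "X \<subseteq> V" "Y \<subseteq> V" using X Y sideD by auto
  show ?thesis
  proof (cases "a \<in> Y")
    case True
    then have "b \<notin> Y" using g ab by (auto simp: edge_cut_def)
    then have "edge_cut E (X - Y) = {}" "edge_cut E (Y - X) = {}"
      using sub(2,3) ab True by (auto simp: edge_cut_def)
    moreover have "X - Y \<noteq> V" "Y - X \<noteq> V" using v XV by auto
    moreover have "X - Y \<subseteq> V" "Y - X \<subseteq> V" using XV by auto
    ultimately have "X - Y = {}" "Y - X = {}" using cut_nonempty by metis+
    then show ?thesis by blast
  next
    case False
    then have "edge_cut E (X \<inter> Y) = {}" using sub(1) ab by (auto simp: edge_cut_def)
    then have "X \<inter> Y = V" using cut_nonempty[of "X \<inter> Y"] XV v by blast
    then show ?thesis using ab by blast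
  qed
qed

text \<open>If all four corners of \<open>X\<close> and \<open>Y\<close> were nonempty, connectivity
  would put an end of \<open>e\<close> or \<open>f\<close> into each corner, which two bridges
  cannot achieve.\<close>

lemma side_laminar:
  assumes X: "side e X" and Y: "side f Y"
  shows "X \<subseteq> Y \<or> Y \<subseteq> X \<or> X \<inter> Y = {} \<or> X \<union> Y = V"
proof (rule ccontr)
  assume "\<not> ?thesis"
  then have n: "X - Y \<noteq> {}" "Y - X \<noteq> {}" "X \<inter> Y \<noteq> {}" "V - (X \<union> Y) \<noteq> {}"
    using sideD(1)[OF X] sideD(1)[OF Y] by auto
  have cutY: "d = f" if "d \<in> E" "d \<inter> Y \<noteq> {}" "\<not> d \<subseteq> Y" for d
    using sideD(2)[OF Y] that by (auto simp: edge_cut_def)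
  have c: "C \<subseteq> V \<Longrightarrow> C \<noteq> {} \<Longrightarrow> C \<noteq> V \<Longrightarrow> edge_cut E C \<subseteq> {e, f} \<Longrightarrow> e \<inter> C \<noteq> {} \<or> f \<inter> C \<noteq> {}" for C
    using cut_nonempty[of C] by (auto simp: edge_cut_def)
  have s: "edge_cut E (X - Y) \<subseteq> {e, f}" "edge_cut E (Y - X) \<subseteq> {e, f}" "edge_cut E (X \<inter> Y) \<subseteq> {e, f}"
    using edge_cut_corners[of E X Y] edge_cut_corners[of E Y X] sideD(2)[OF X] sideD(2)[OF Y] by auto
  have s4: "edge_cut E (V - (X \<union> Y)) \<subseteq> {e, f}"
    using edge_cut_corners(2)[of E X Y] sideD(2)[OF X] sideD(2)[OF Y] unfolding edge_cut_Diff by auto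
  have XV: "X \<subseteq> V" "Y \<subseteq> V" using X Y sideD by auto
  have meets: "e \<inter> (X - Y) \<noteq> {} \<or> f \<inter> (X - Y) \<noteq> {}" "e \<inter> (Y - X) \<noteq> {} \<or> f \<inter> (Y - X) \<noteq> {}"
    "e \<inter> (X \<inter> Y) \<noteq> {} \<or> f \<inter> (X \<inter> Y) \<noteq> {}"
    "e \<inter> (V - (X \<union> Y)) \<noteq> {} \<or> f \<inter> (V - (X \<union> Y)) \<noteq> {}"
    by (rule c[OF _ _ _ s(1)] c[OF _ _ _ s(2)] c[OF _ _ _ s(3)] c[OF _ _ _ s4]; use n XV in auto)+
  obtain a b where ab: "e = {b, a}" "a \<in> X" "b \<in> V - X" using side_edgeE[OF X] .
  obtain p q where pq: "f = {q, p}" "p \<in> Y" "q \<in> V - Y" using side_edgeE[OF Y] .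
  \<comment> \<open>If \<open>e\<close> and \<open>f\<close> differ, both ends of \<open>e\<close>
    lie on the same side of \<open>Y\<close>. On the other side there are two corners but only one
    end of \<open>f\<close>.\<close>
  have "e = f \<or> (a \<in> Y \<longleftrightarrow> b \<in> Y)" using cutY[OF sideD(3)[OF X]] ab by auto
  with meets ab pq show False by auto
qed

text \<open>The vertices reachable from \<open>v\<close> without \<open>g\<close> stay inside
  \<open>X\<close> and form a side of \<open>g\<close> themselves, so uniqueness makes them all of
  \<open>X\<close>.\<close>

lemma relevance_side:
  assumes X: "side g X" and "v \<in> X"
  shows "relevance V E g v = card (V - X)"
proof -
  have v: "v \<in> V" using assms sideD(1) by auto
  have sub: "reach g v \<subseteq> X"
    using reach_subset_side[of X g v] assms sideD(2) by blast
  then have "edge_cut E (reach g v) \<noteq> {}"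
    using cut_nonempty[OF reach_subset] self_in_reach[OF v] sideD(1,5)[OF X] by blast
  then have "side g (reach g v)" using edge_cut_reach[of g v] reach_subset unfolding side_def by blast
  then have "reach g v = X" using side_unique[OF _ X self_in_reach[OF v] \<open>v \<in> X\<close>] by blast
  then show ?thesis by (simp add: relevance_reach)
qed

lemma relevance_side_out:
  assumes "side g X" "v \<in> V - X"
  shows "relevance V E g v = card X"
proof -
  have "V - (V - X) = X" using sideD(1)[OF assms(1)] by blast
  then show ?thesis using relevance_side[OF side_Diff[OF assms(1)] assms(2)] by simp
qed

lemma relevance_pos:
  assumes "relevance V E g v > 0" "v \<in> V"
  obtains X where "side g X" "v \<in> X"
proof -
  have "reach g v \<noteq> V" using assms(1) by (auto simp: relevance_reach)
  then have "edge_cut E (reach g v) \<noteq> {}"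
    using cut_nonempty[OF reach_subset] self_in_reach[OF assms(2)] by blast
  then have "side g (reach g v)" using edge_cut_reach[of g v] reach_subset unfolding side_def by blast
  then show thesis using that self_in_reach[OF assms(2)] by blast
qed

lemma separation_side:
  assumes X: "side g X"
  shows "separation V E g = 2 * card X * card (V - X)"
proof -
  have "separation V E g = (\<Sum>v\<in>X. relevance V E g v) + (\<Sum>v\<in>V - X. relevance V E g v)"
    unfolding separation_def using sum.subset_diff[OF sideD(1)[OF X] finite_V] by (simp add: add.commute)
  also have "\<dots> = (\<Sum>v\<in>X. card (V - X)) + (\<Sum>v\<in>V - X. card X)"
    using relevance_side[OF X] relevance_side_out[OF X] by (intro arg_cong2[where f="(+)"] sum.cong) auto
  finally show ?thesis by simp
qed

lemma separation_le_max: "g \<in> E \<Longrightarrow> separation V E g \<le> max_separation V E"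
  unfolding max_separation_def using finite_E by auto

lemma finite_max_sep_edges: "finite (max_sep_edges V E)"
  using finite_E by (simp add: max_sep_edges_def)

lemma max_sep_edges_nonempty:
  assumes "E \<noteq> {}"
  shows "max_sep_edges V E \<noteq> {}"
proof -
  have "max_separation V E \<in> separation V E ` E"
    unfolding max_separation_def using finite_E assms by (intro Max_in) auto
  then show ?thesis by (auto simp: max_sep_edges_def)
qed

text \<open>Real-valued form of the disconnection cost, which is finite because the graph is
  connected.\<close>

definition disc :: "'a \<Rightarrow> real" where
  "disc v = 1 / real (card (max_sep_edges V E)) * (\<Sum>e\<in>max_sep_edges V E. real (relevance V E e v))"

lemma disconnection_cost_eq: "disconnection_cost V E v = ereal (disc v)"
  using conn by (simp add: disconnection_cost_def disc_def)

lemma disc_le: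
  assumes s: "0 \<le> s" and v: "v \<in> V" and *: "\<And>g X. side g X \<Longrightarrow> v \<in> X \<Longrightarrow> real (card (V - X)) \<le> s"
  shows "disc v \<le> s"
proof -
  have "real (relevance V E g v) \<le> s" for g
  proof (cases "relevance V E g v > 0")
    case True
    then obtain X where X: "side g X" "v \<in> X" using relevance_pos v by blast
    show ?thesis using *[OF X] by (simp add: relevance_side[OF X])
  qed (use s in auto)
  then have "(\<Sum>e\<in>max_sep_edges V E. real (relevance V E e v)) \<le> real (card (max_sep_edges V E)) * s"
    by (rule sum_bounded_above)
  then have "disc v \<le> 1 / real (card (max_sep_edges V E)) * (real (card (max_sep_edges V E)) * s)"
    unfolding disc_def by (intro mult_left_mono) auto
  \<comment> \<open>If there is no critical edge, division by zero makes the left-hand side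
    \<open>0\<close>.\<close>
  also have "\<dots> \<le> s" using s by auto
  finally show ?thesis .
qed

text \<open>Exchanging the sums turns the relevances of each critical edge into its separation,
  which is the maximum.\<close>

lemma sum_disc:
  assumes "E \<noteq> {}"
  shows "(\<Sum>v\<in>V. disc v) = real (max_separation V E)"
proof -
  let ?M = "max_sep_edges V E"
  have c: "card ?M \<noteq> 0" using max_sep_edges_nonempty[OF assms] finite_max_sep_edges by simp
  have "(\<Sum>v\<in>V. disc v) = 1 / real (card ?M) * (\<Sum>v\<in>V. \<Sum>e\<in>?M. real (relevance V E e v))"
    unfolding disc_def by (simp add: sum_distrib_left)
  also have "(\<Sum>v\<in>V. \<Sum>e\<in>?M. real (relevance V E e v)) = (\<Sum>e\<in>?M. real (separation V E e))"
    unfolding separation_def by (subst sum.swap) simp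
  also have "\<dots> = (\<Sum>e\<in>?M. real (max_separation V E))"
    by (rule sum.cong) (auto simp: max_sep_edges_def)
  finally show ?thesis using c by simp
qed

end

section \<open>Sparse edge sets that meet every nonempty cut\<close>

text \<open>Symmetric difference with \<open>X\<close> injects the empty cuts of \<open>insert e F\<close> into the empty cuts
  of \<open>F\<close> that \<open>e\<close> crosses.\<close>

lemma edge_cut_certificate_step:
  assumes "finite V" and X: "X \<subseteq> V" "edge_cut F X = {}" and e: "\<exists>a b. e = {a, b} \<and> a \<in> X \<and> b \<notin> X"
  shows "2 * card {Y. Y \<subseteq> V \<and> edge_cut (insert e F) Y = {}} \<le> card {Y. Y \<subseteq> V \<and> edge_cut F Y = {}}"
proof -
  let ?Z = "{Y. Y \<subseteq> V \<and> edge_cut F Y = {}}" and ?Z' = "{Y. Y \<subseteq> V \<and> edge_cut (insert e F) Y = {}}"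
  let ?f = "\<lambda>Y. (Y - X) \<union> (X - Y)"
  have fin: "finite ?Z" using assms(1) by simp
  have sub: "?Z' \<subseteq> ?Z" by (auto simp: edge_cut_def)
  have img: "?f ` ?Z' \<subseteq> ?Z - ?Z'"
  proof
    fix W assume "W \<in> ?f ` ?Z'"
    then obtain Y where Y: "Y \<subseteq> V" "edge_cut (insert e F) Y = {}" "W = ?f Y" by auto
    have FY: "edge_cut F Y = {}" using Y(2) by (auto simp: edge_cut_def)
    have "edge_cut F W \<subseteq> edge_cut F (Y - X) \<union> edge_cut F (X - Y)"
      unfolding Y(3) by (rule edge_cut_corners)
    also have "\<dots> = {}"
      using edge_cut_corners(3)[of F Y X] edge_cut_corners(3)[of F X Y] FY X(2) by auto
    finally have "edge_cut F W = {}" by simp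
    moreover have "W \<subseteq> V" using Y X by auto
    moreover obtain a b where ab: "e = {a, b}" "a \<in> X" "b \<notin> X" using e by blast
    \<comment> \<open>As \<open>e\<close> crosses \<open>X\<close> but not \<open>Y\<close>, exactly
      one end of \<open>e\<close> lies in the symmetric difference.\<close>
    have "a \<in> Y \<longleftrightarrow> b \<in> Y" using Y(2) ab by (auto simp: edge_cut_def)
    then have "e \<in> edge_cut (insert e F) W" using ab Y(3) by (auto simp: edge_cut_def)
    ultimately show "W \<in> ?Z - ?Z'" by blast
  qed
  have "inj_on ?f ?Z'" by (rule inj_onI) blast
  then have "card ?Z' = card (?f ` ?Z')" by (simp add: card_image)
  also have "\<dots> \<le> card (?Z - ?Z')" using fin img by (intro card_mono) auto
  also have "\<dots> = card ?Z - card ?Z'" using fin sub by (intro card_Diff_subset finite_subset[OF sub fin])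
  finally show ?thesis using card_mono[OF fin sub] by simp
qed

context finite_graph
begin

text \<open>Edges are added greedily. Every added edge at least halves the number of vertex sets with empty
  cut, of which there are \<open>2 ^ card V\<close> at the start; so at most \<open>card V\<close> edges are added.\<close>

lemma edge_cut_certificate:
  "\<exists>F\<subseteq>E. card F \<le> card V \<and> (\<forall>X\<subseteq>V. edge_cut F X = {} \<longrightarrow> edge_cut E X = {})"
proof -
  let ?Z = "\<lambda>F. card {Y. Y \<subseteq> V \<and> edge_cut F Y = {}}"
  \<comment> \<open>The induction over \<open>D\<close> carries a potential: the number of empty
    cuts of \<open>F\<close> times \<open>2 ^ card F\<close> never exceeds
    \<open>2 ^ card V\<close>.\<close>
  have "\<exists>F\<subseteq>D. (\<forall>X\<subseteq>V. edge_cut F X = {} \<longrightarrow> edge_cut D X = {}) \<and> ?Z F * 2 ^ card F \<le> 2 ^ card V"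
    if "finite D" "D \<subseteq> E" for D
    using that
  proof (induction D rule: finite_induct)
    case empty
    have "{Y. Y \<subseteq> V \<and> edge_cut {} Y = {}} = Pow V" by (auto simp: edge_cut_def)
    then show ?case using finite_V by (intro exI[of _ "{}"]) (simp add: card_Pow)
  next
    case (insert e D)
    then obtain F where F: "F \<subseteq> D" "\<forall>X\<subseteq>V. edge_cut F X = {} \<longrightarrow> edge_cut D X = {}"
      "?Z F * 2 ^ card F \<le> 2 ^ card V" by auto
    show ?case
    proof (cases "\<exists>X\<subseteq>V. edge_cut F X = {} \<and> e \<in> edge_cut E X")
      \<comment> \<open>Here \<open>e\<close> crosses no empty cut of \<open>F\<close>, so
        \<open>F\<close> already serves for \<open>insert e D\<close>.\<close>
      case False
      have "\<forall>X\<subseteq>V. edge_cut F X = {} \<longrightarrow> edge_cut (insert e D) X = {}"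
      proof (intro allI impI)
        fix X assume X: "X \<subseteq> V" "edge_cut F X = {}"
        then have "e \<notin> edge_cut E X" "edge_cut D X = {}" using False F(2) by blast+
        moreover have "e \<in> E" using insert.prems by simp
        ultimately show "edge_cut (insert e D) X = {}" by (simp add: edge_cut_def) blast
      qed
      moreover have "F \<subseteq> insert e D" using F(1) by blast
      ultimately show ?thesis using F(3) by blast
    next
      case True
      then obtain X where X: "X \<subseteq> V" "edge_cut F X = {}" "e \<in> edge_cut E X" by blast
      have "\<exists>a b. e = {a, b} \<and> a \<in> X \<and> b \<notin> X" by (rule edge_cutE[OF X(3)]) auto
      then have "2 * ?Z (insert e F) \<le> ?Z F"
        by (rule edge_cut_certificate_step[OF finite_V X(1,2)])
      moreover have "e \<notin> F" "finite F" using F insert by (auto intro: finite_subset)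
      ultimately have "?Z (insert e F) * 2 ^ card (insert e F) \<le> ?Z F * 2 ^ card F"
        using mult_right_mono[of "2 * ?Z (insert e F)" "?Z F" "2 ^ card F"] by (simp add: mult_ac)
      then have "?Z (insert e F) * 2 ^ card (insert e F) \<le> 2 ^ card V" using F(3) by linarith
      moreover have "\<forall>X\<subseteq>V. edge_cut (insert e F) X = {} \<longrightarrow> edge_cut (insert e D) X = {}"
      proof (intro allI impI)
        fix X assume X: "X \<subseteq> V" "edge_cut (insert e F) X = {}"
        then have "edge_cut F X = {}" by (auto simp: edge_cut_def)
        then have "edge_cut D X = {}" using F(2) X(1) by blast
        then show "edge_cut (insert e D) X = {}" using X(2) by (simp add: edge_cut_def) blast
      qed
      moreover have "insert e F \<subseteq> insert e D" using F(1) by blast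
      ultimately show ?thesis by blast
    qed
  qed
  from this[OF finite_E] obtain F where F: "F \<subseteq> E" "\<forall>X\<subseteq>V. edge_cut F X = {} \<longrightarrow> edge_cut E X = {}"
    "?Z F * 2 ^ card F \<le> 2 ^ card V" by auto
  \<comment> \<open>The empty set always has an empty cut. The count is therefore positive, and the
    potential bounds \<open>card F\<close>.\<close>
  have "{} \<in> {Y. Y \<subseteq> V \<and> edge_cut F Y = {}}" by (simp add: edge_cut_def)
  then have "?Z F > 0" using finite_V by (auto simp: card_gt_0_iff)
  then have "(2::nat) ^ card F \<le> 2 ^ card V" 
    using F(3) mult_le_mono1[of 1 "?Z F" "2 ^ card F"] by linarith
  then have "card F \<le> card V" by simp
  with F show ?thesis by auto
qed

end

section \<open>The maximal separation of a stable graph\<close>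

context conn_graph
begin

lemma separation_pos_side:
  assumes "separation V E g > 0"
  obtains X where "side g X"
proof -
  have "\<exists>v\<in>V. relevance V E g v \<noteq> 0"
    using assms by (auto simp: separation_def intro: ccontr)
  then obtain v where "v \<in> V" "relevance V E g v > 0" by auto
  then show thesis using relevance_pos that by metis
qed

lemma card_Diff_side: "side g X \<Longrightarrow> card (V - X) = card V - card X \<and> 0 < card X \<and> card X < card V"
  using sideD[of g X] finite_V
  by (auto simp: card_Diff_subset finite_subset card_gt_0_iff psubset_card_mono)

lemma real_separation_side:
  "side g X \<Longrightarrow> real (separation V E g) = 2 * real (card X) * (real (card V) - real (card X))"
  using separation_side card_Diff_side by (simp add: of_nat_diff less_imp_le)

lemma max_separation_side:
  assumes "E \<noteq> {}" "max_separation V E > 0"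
  obtains e A where "e \<in> max_sep_edges V E" "side e A" "2 * card A \<le> card V"
proof -
  obtain e where e: "e \<in> max_sep_edges V E" using max_sep_edges_nonempty[OF assms(1)] by auto
  then have "separation V E e > 0" using assms(2) by (simp add: max_sep_edges_def)
  then obtain X where X: "side e X" by (rule separation_pos_side)
  show thesis
  proof (cases "2 * card X \<le> card V")
    case False
    then have "2 * card (V - X) \<le> card V" using card_Diff_side[OF X] by auto
    then show ?thesis using that[OF e side_Diff[OF X]] by blast
  qed (use that[OF e X] in blast)
qed

text \<open>The product \<open>x * (n - x)\<close> determines \<open>x\<close> up to exchange with
  \<open>n - x\<close>, so one of the two sides of \<open>g\<close> has the size of
  \<open>A\<close>.\<close>

lemma equal_separation_side:
  assumes "side e A" "side g X" "separation V E g = separation V E e"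
  obtains Y where "side g Y" "card Y = card A"
proof -
  let ?n = "int (card V)" and ?k = "int (card A)" and ?x = "int (card X)"
  have c: "card (V - X) = card V - card X" "card X < card V" "card (V - A) = card V - card A" "card A < card V"
    using card_Diff_side[OF assms(1)] card_Diff_side[OF assms(2)] by auto
  have "card X * (card V - card X) = card A * (card V - card A)"
    using assms(3) c by (simp add: separation_side[OF assms(1)] separation_side[OF assms(2)])
  then have "?x * (?n - ?x) = ?k * (?n - ?k)"
    using c by (metis of_nat_mult of_nat_diff less_imp_le_nat)
  then have "(?x - ?k) * (?n - ?x - ?k) = 0" by (simp add: algebra_simps)
  then have "card X = card A \<or> card (V - X) = card A" using c by auto
  then show thesis using that assms(2) side_Diff by blast
qed

text \<open>Apply laminarity: equal sizes exclude inclusion, and two sets of size at most half that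
  cover \<open>V\<close> must be disjoint.\<close>

lemma small_sides_disjoint:
  assumes X: "side g X" and Y: "side h Y" and ne: "g \<noteq> h"
    and c: "card X = k" "card Y = k" "2 * k \<le> card V"
  shows "X \<inter> Y = {}"
proof -
  have fin: "finite X" "finite Y" using X Y sideD(1) finite_V finite_subset by metis+
  have "X \<noteq> Y" using sideD(2)[OF X] sideD(2)[OF Y] ne by auto
  then have "\<not> X \<subseteq> Y" "\<not> Y \<subseteq> X" using c fin card_subset_eq by metis+
  moreover have "X \<inter> Y = {}" if "X \<union> Y = V"
  proof -
    have "card (X \<inter> Y) = 0" using card_Un_Int[OF fin] that c by simp
    then show ?thesis using fin by simp
  qed
  ultimately show ?thesis using side_laminar[OF X Y] by blast
qed

text \<open>Let \<open>t\<close> be the number of critical bridges, \<open>k = card A\<close> and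
  \<open>n = card V\<close>. From \<open>v\<close>, the bridge \<open>e\<close> cuts off
  \<open>n - k\<close> vertices and each other critical bridge cuts off \<open>k\<close>, so the
  cost is \<open>k + (n - 2 * k) / t\<close>. Disjointness of the small sides gives
  \<open>t * k \<le> n\<close>.\<close>

lemma max_separation_le_disc:
  assumes e: "e \<in> max_sep_edges V E" and A: "side e A" and small: "2 * card A \<le> card V" and v: "v \<in> A"
  shows "real (max_separation V E) \<le> real (card V) * disc v"
proof -
  let ?M = "max_sep_edges V E"
  let ?n = "real (card V)" and ?k = "real (card A)" and ?t = "real (card ?M)"
  have cA: "0 < card A" "card A < card V" "card (V - A) = card V - card A"
    using card_Diff_side[OF A] by auto
  have sepe: "separation V E e = max_separation V E" using e by (simp add: max_sep_edges_def)
  then have sepM: "separation V E g = separation V E e" if "g \<in> ?M" for g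
    using that by (simp add: max_sep_edges_def)
  have sep: "separation V E e = 2 * card A * (card V - card A)"
    using separation_side[OF A] cA by simp
  \<comment> \<open>The side chosen for \<open>e\<close> is fixed to be \<open>A\<close>, since both
    sides of \<open>e\<close> may have this size and \<open>v\<close> lies in
    \<open>A\<close>.\<close>
  have "\<exists>X. side g X \<and> card X = card A \<and> (g = e \<longrightarrow> X = A)" if "g \<in> ?M" for g
  proof (cases "g = e")
    case False
    have "separation V E g > 0" using sepM[OF that] sep cA by simp
    then obtain X where "side g X" by (rule separation_pos_side)
    from equal_separation_side[OF A this sepM[OF that]] False show ?thesis by metis
  qed (use A in auto)
  then obtain X where X: "\<And>g. g \<in> ?M \<Longrightarrow> side g (X g)" "\<And>g. g \<in> ?M \<Longrightarrow> card (X g) = card A" "X e = A"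
    using e by metis
  have disj: "X g \<inter> X h = {}" if "g \<in> ?M" "h \<in> ?M" "g \<noteq> h" for g h
    using small_sides_disjoint[OF X(1)[OF that(1)] X(1)[OF that(2)] that(3)] X(2) that small by blast
  have finX: "finite (X g)" if "g \<in> ?M" for g
    using sideD(1)[OF X(1)[OF that]] finite_V finite_subset by blast
  have "card (\<Union>g\<in>?M. X g) = (\<Sum>g\<in>?M. card (X g))"
    using finite_max_sep_edges finX disj by (intro card_UN_disjoint) auto
  also have "\<dots> = card ?M * card A" using X(2) by simp
  finally have "card ?M * card A = card (\<Union>g\<in>?M. X g)" ..
  also have "\<dots> \<le> card V" using X(1) sideD(1) finite_V by (intro card_mono) blast+
  finally have tk: "?t * ?k \<le> ?n" by (metis of_nat_le_iff of_nat_mult)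
  have t: "?t \<ge> 1" using e finite_max_sep_edges by (simp add: card_gt_0_iff Suc_le_eq) auto
  have rel: "real (relevance V E g v) = ?k" if "g \<in> ?M - {e}" for g
  proof -
    have "v \<in> V - X g" using disj[of g e] that e X(3) v sideD(1)[OF A] by auto
    then show ?thesis using relevance_side_out[OF X(1)] X(2) that by simp
  qed
  have "(\<Sum>g\<in>?M. real (relevance V E g v)) = real (relevance V E e v) + (\<Sum>g\<in>?M - {e}. real (relevance V E g v))"
    using e finite_max_sep_edges by (rule sum.remove[rotated])
  also have "\<dots> = (?n - ?k) + (?t - 1) * ?k"
    using rel relevance_side[OF A v] cA e finite_max_sep_edges t by (simp add: of_nat_diff)
  finally have "disc v = ?k + (?n - 2 * ?k) / ?t"
    using t unfolding disc_def by (simp add: field_simps)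
  \<comment> \<open>This uses \<open>k \<le> n / t\<close>. The factor \<open>n - 2 * k\<close> is
    nonnegative because \<open>A\<close> is a smaller side.\<close>
  moreover have "(?n - 2 * ?k) * ?k \<le> (?n - 2 * ?k) * (?n / ?t)"
    using tk t small by (intro mult_left_mono) (simp_all add: pos_le_divide_eq mult.commute)
  moreover have "real (max_separation V E) = 2 * ?k * (?n - ?k)"
    using real_separation_side[OF A] sepe by simp
  moreover have "?n * (?k + (?n - 2 * ?k) / ?t) = ?n * ?k + (?n - 2 * ?k) * (?n / ?t)"
    by (simp add: distrib_left)
  moreover have "2 * ?k * (?n - ?k) = ?n * ?k + (?n - 2 * ?k) * ?k" by (simp add: algebra_simps)
  ultimately show ?thesis by simp
qed

section \<open>The effect of one additional link\<close>

lemma conn_graph_insert: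
  assumes "v \<in> V" "w \<in> V" "v \<noteq> w"
  shows "conn_graph V (insert {v, w} E)"
proof -
  interpret N: finite_graph V "insert {v, w} E"
    using finite_V edges assms by unfold_locales auto
  have "edge_cut E X \<subseteq> edge_cut (insert {v, w} E) X" for X by (rule edge_cut_mono) blast
  then have "connected_graph V (insert {v, w} E)"
    using N.connected_graph_iff_cut cut_nonempty by (metis subset_empty)
  then show ?thesis by unfold_locales
qed

text \<open>A new link creates no bridge and destroys those that separate its ends. The remaining
  bridges are old ones with \<open>v\<close> and \<open>w\<close> on the same side.\<close>

lemma disc_insert_le:
  assumes vw: "v \<in> V" "w \<in> V" "v \<noteq> w" "{v, w} \<notin> E" and s: "0 \<le> s"
    and *: "\<And>g X. side g X \<Longrightarrow> v \<in> X \<Longrightarrow> w \<in> X \<Longrightarrow> real (card (V - X)) \<le> s"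
  shows "conn_graph.disc V (insert {v, w} E) v \<le> s"
proof -
  interpret N: conn_graph V "insert {v, w} E" using conn_graph_insert vw by blast
  show ?thesis
  proof (rule N.disc_le[OF s vw(1)])
    fix g X assume X: "N.side g X" "v \<in> X"
    have c: "edge_cut (insert {v, w} E) X = {g}" "X \<subseteq> V" "X \<noteq> {}" "X \<noteq> V"
      using N.sideD[OF X(1)] by auto
    have "edge_cut E X \<subseteq> {g}"
      unfolding c(1)[symmetric] by (rule edge_cut_mono) blast
    then have sub: "edge_cut E X = {g}" using cut_nonempty[OF c(2-4)] by blast
    have "w \<in> X"
    proof (rule ccontr)
      assume "w \<notin> X"
      then have "{v, w} \<in> edge_cut (insert {v, w} E) X" using X by (simp add: edge_cut_def)
      then have "{v, w} \<in> edge_cut E X" unfolding c(1) sub .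
      with vw(4) show False by (simp add: edge_cut_def)
    qed
    moreover have "side g X" using sub c by (simp add: side_def)
    ultimately show "real (card (V - X)) \<le> s" using * X by blast
  qed
qed

lemma side_edge_mem:
  assumes "side g X" "{v, w} \<in> E" "v \<in> X" "w \<notin> X"
  shows "g = {v, w}"
proof -
  have "{v, w} \<in> edge_cut E X" using assms by (auto simp: edge_cut_def)
  then show ?thesis using sideD(2)[OF assms(1)] by simp
qed

lemma side_edge_in:
  assumes X: "side g X" "v \<in> X" and P: "side f P" "f = {u, v}" and "g \<noteq> f"
  shows "u \<in> X"
proof (rule ccontr)
  assume "u \<notin> X"
  moreover have "{v, u} \<in> E" using sideD(3)[OF P(1)] P(2) by (simp add: insert_commute)
  ultimately show False using side_edge_mem[OF X(1)] X(2) assms(4,5) by (metis insert_commute)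
qed

text \<open>The deviation links the end \<open>v\<close> in \<open>A\<close> of \<open>e\<close> to
  some \<open>w\<close> beyond the other end \<open>u\<close>. A bridge that still cuts off more
  than \<open>card A\<close> vertices from \<open>v\<close> would have two sides larger than
  \<open>A\<close>, hence a separation above the maximum.\<close>

lemma max_separation_bound_small:
  assumes e: "e \<in> max_sep_edges V E" and A: "side e A" and small: "3 * card A \<le> card V"
    and n: "card V \<ge> 3"
    and stable: "\<And>v w. v \<in> V \<Longrightarrow> w \<in> V \<Longrightarrow> v \<noteq> w \<Longrightarrow> {v, w} \<notin> E \<Longrightarrow>
      disc v \<le> \<alpha> + conn_graph.disc V (insert {v, w} E) v"
  shows "real (max_separation V E) \<le> 6 * \<alpha> * real (card V)"
proof -
  let ?n = "real (card V)" and ?k = "real (card A)"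
  have cA: "0 < card A" "card A < card V" "card (V - A) = card V - card A"
    using card_Diff_side[OF A] by auto
  have AV: "A \<subseteq> V" using sideD[OF A] by auto
  have fA: "finite A" using AV finite_V finite_subset by blast
  obtain u v where uv: "e = {u, v}" "v \<in> A" "u \<in> V - A" by (rule side_edgeE[OF A])
  \<comment> \<open>A target \<open>w\<close> other than \<open>u\<close> is wanted so that the link
    is new: \<open>e\<close> is the only edge leaving \<open>A\<close>.\<close>
  have "card {u} < card (V - A)" using cA n small by simp
  then obtain w where w: "w \<in> V - A" "w \<noteq> u"
    by (metis card_mono finite.emptyI finite.insertI insertI1 not_le subsetI insert_iff)
  have vw: "v \<in> V" "w \<in> V" "v \<noteq> w" using uv w AV by auto
  have ne: "{v, w} \<notin> E"
    using side_edge_mem[OF A, of v w] uv w by (auto simp: doubleton_eq_iff)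
  have sepe: "max_separation V E = 2 * card A * (card V - card A)"
    using e separation_side[OF A] cA by (simp add: max_sep_edges_def)
  have "conn_graph.disc V (insert {v, w} E) v \<le> ?k"
  proof (rule disc_insert_le[OF vw ne])
    fix g X assume X: "side g X" "v \<in> X" "w \<in> X"
    have XV: "X \<subseteq> V" "finite X" using sideD(1)[OF X(1)] finite_V finite_subset by auto
    have cX: "card (V - X) = card V - card X" "card X < card V" using card_Diff_side[OF X(1)] by auto
    have ge: "g \<noteq> e" using side_unique[OF X(1) _ X(2) uv(2)] A w X(3) by auto
    then have "u \<in> X" using side_edge_in[OF X(1,2) A uv(1)] by blast
    then have "\<not> X \<subseteq> A" "A \<inter> X \<noteq> {}" using uv X by auto
    then consider "A \<subseteq> X" | "A \<union> X = V" using side_laminar[OF A X(1)] by blast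
    then have "card A < card X"
    proof cases
      case 1
      then show ?thesis using uv \<open>u \<in> X\<close> XV by (intro psubset_card_mono) auto
    next
      case 2
      have "card V - card A \<le> card X"
        unfolding cA(3)[symmetric] using 2 XV by (intro card_mono) auto
      then show ?thesis using small cA by linarith
    qed
    show "real (card (V - X)) \<le> ?k"
    proof (rule ccontr)
      assume a: "\<not> real (card (V - X)) \<le> ?k"
      define x k m where "x = int (card X)" and "k = int (card A)" and "m = int (card V)"
      note xkm = this
      have "x > k" "m - x > k" using a \<open>card A < card X\<close> cX by (auto simp: xkm)
      \<comment> \<open>This product is the difference of \<open>x * (m - x)\<close> and
        \<open>k * (m - k)\<close>.\<close>
      then have "(x - k) * (m - x - k) > 0" by simp
      then have "x * (m - x) > k * (m - k)" by (simp add: algebra_simps)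
      then have "int (card X * (card V - card X)) > int (card A * (card V - card A))"
        using cX cA by (simp add: xkm of_nat_diff)
      then have "card X * card (V - X) > card A * (card V - card A)"
        by (simp only: of_nat_less_iff cX(1))
      then have "separation V E g > max_separation V E"
        using separation_side[OF X(1)] sepe by (simp add: mult.assoc)
      then show False using separation_le_max[OF sideD(3)[OF X(1)]] by simp
    qed
  qed simp
  then have "disc v \<le> \<alpha> + ?k" using stable[OF vw ne] by linarith
  then have "?n * disc v \<le> ?n * (\<alpha> + ?k)" by (intro mult_left_mono) auto
  moreover have "real (max_separation V E) \<le> ?n * disc v"
    using max_separation_le_disc[OF e A _ uv(2)] small by simp
  moreover have M: "real (max_separation V E) = 2 * ?k * (?n - ?k)"
    using e real_separation_side[OF A] by (simp add: max_sep_edges_def)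
  ultimately have "2 * ?k * (?n - ?k) \<le> ?n * (\<alpha> + ?k)" by linarith
  then have "?k * (?n - 2 * ?k) \<le> ?n * \<alpha>" by (simp add: algebra_simps)
  \<comment> \<open>The smaller side holds at most a third of the vertices, so
    \<open>n - 2 * k\<close> is at least \<open>n / 3\<close>.\<close>
  moreover have "?k * (?n / 3) \<le> ?k * (?n - 2 * ?k)" using small by (intro mult_left_mono) auto
  ultimately have "?k * ?n \<le> 3 * \<alpha> * ?n" by (simp add: algebra_simps)
  moreover have "2 * ?k * (?n - ?k) \<le> 2 * (?k * ?n)" by (simp add: algebra_simps)
  ultimately show ?thesis using M by linarith
qed

section \<open>Bridges with more than a third of the vertices on either side\<close>

definition heavy :: "'a set \<Rightarrow> bool" where
  "heavy X \<longleftrightarrow> (\<exists>g. side g X) \<and> card V < 3 * card X \<and> card V < 3 * card (V - X)"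

lemma heavy_Diff: "heavy X \<Longrightarrow> heavy (V - X)"
proof -
  assume h: "heavy X"
  then have "V - (V - X) = X" using sideD(1) by (auto simp: heavy_def)
  with h side_Diff show ?thesis unfolding heavy_def by metis
qed

text \<open>Provides an end of the path of heavy bridges. Least cardinality among the heavy subsets
  of \<open>A\<close> gives minimality under inclusion.\<close>

lemma heavy_min:
  assumes "heavy A"
  obtains P where "heavy P" "P \<subseteq> A" "\<And>X. heavy X \<Longrightarrow> X \<subseteq> P \<Longrightarrow> X = P"
proof -
  obtain P where P: "heavy P \<and> P \<subseteq> A" "\<And>X. heavy X \<and> X \<subseteq> A \<Longrightarrow> card P \<le> card X"
    using assms ex_has_least_nat[of "\<lambda>P. heavy P \<and> P \<subseteq> A" A card] by auto
  have "X = P" if "heavy X" "X \<subseteq> P" for X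
  proof (rule card_seteq)
    show "finite P" using P(1) sideD(1) finite_V finite_subset unfolding heavy_def by metis
    show "card P \<le> card X" using P that by blast
  qed (fact that)
  then show thesis using that P by blast
qed

text \<open>Among the laminar cases, \<open>X \<subseteq> P\<close> gives equality by minimality and
  \<open>v\<close> excludes disjointness. If \<open>P \<union> X = V\<close>, then
  \<open>V - X\<close> is a heavy subset of \<open>P\<close>, hence equal to \<open>P\<close>,
  although \<open>v\<close> lies in both \<open>P\<close> and \<open>X\<close>.\<close>

lemma heavy_min_subset:
  assumes P: "heavy P" "\<And>X. heavy X \<Longrightarrow> X \<subseteq> P \<Longrightarrow> X = P" and X: "heavy X" "v \<in> X" "v \<in> P"
  shows "P \<subseteq> X"
proof -
  obtain f g where "side f P" "side g X" using P X by (auto simp: heavy_def)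
  from side_laminar[OF this] consider "P \<subseteq> X" | "X \<subseteq> P" | "P \<inter> X = {}" | "P \<union> X = V" by blast
  then show ?thesis
  proof cases
    case 4
    then have "V - X = P" using P(2)[OF heavy_Diff[OF X(1)]] by blast
    with X show ?thesis by blast
  qed (use P X in blast)+
qed

text \<open>The deviation links minimal heavy sets \<open>P\<close> and \<open>Q\<close> on opposite
  sides of \<open>e\<close>. Three disjoint sets cannot each exceed a third of \<open>V\<close>, so
  no heavy bridge keeps both ends of the link on one side.\<close>

lemma max_separation_bound_large:
  assumes e: "e \<in> max_sep_edges V E" and A: "side e A" and half: "2 * card A \<le> card V"
    and large: "card V < 3 * card A" and n: "card V \<ge> 3"
    and stable: "\<And>v w. v \<in> V \<Longrightarrow> w \<in> V \<Longrightarrow> v \<noteq> w \<Longrightarrow> {v, w} \<notin> E \<Longrightarrow>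
      disc v \<le> \<alpha> + conn_graph.disc V (insert {v, w} E) v"
  shows "real (max_separation V E) \<le> 6 * \<alpha> * real (card V)"
proof -
  let ?n = "real (card V)" and ?k = "real (card A)"
  have cA: "0 < card A" "card A < card V" "card (V - A) = card V - card A"
    using card_Diff_side[OF A] by auto
  have hA: "heavy A" using A large half cA by (auto simp: heavy_def)
  obtain P where P: "heavy P" "P \<subseteq> A" "\<And>X. heavy X \<Longrightarrow> X \<subseteq> P \<Longrightarrow> X = P"
    using heavy_min[OF hA] by metis
  obtain Q where Q: "heavy Q" "Q \<subseteq> V - A" "\<And>X. heavy X \<Longrightarrow> X \<subseteq> Q \<Longrightarrow> X = Q"
    using heavy_min[OF heavy_Diff[OF hA]] by metis
  obtain f where f: "side f P" using P(1) by (auto simp: heavy_def)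
  obtain u v where uv: "f = {u, v}" "v \<in> P" "u \<in> V - P" by (rule side_edgeE[OF f])
  have AV: "A \<subseteq> V" using sideD[OF A] by auto
  have fin: "finite P" "finite Q" using P Q AV finite_V finite_subset by (metis Diff_subset)+
  \<comment> \<open>Since \<open>f\<close> is the only edge leaving \<open>P\<close>, avoiding
    \<open>u\<close> makes the link from \<open>v\<close> to \<open>w\<close> new.\<close>
  have "card {u} < card Q" using Q(1) n by (auto simp: heavy_def)
  then obtain w where w: "w \<in> Q" "w \<noteq> u"
    by (metis card_mono finite.emptyI finite.insertI insertI1 not_le subsetI insert_iff)
  have vw: "v \<in> V" "w \<in> V" "v \<noteq> w" "w \<notin> P" using uv w AV P Q by auto
  have ne: "{v, w} \<notin> E"
    using side_edge_mem[OF f, of v w] uv w vw by (auto simp: doubleton_eq_iff)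
  have "conn_graph.disc V (insert {v, w} E) v \<le> ?n / 3"
  proof (rule disc_insert_le[OF vw(1-3) ne])
    fix g X assume X: "side g X" "v \<in> X" "w \<in> X"
    have XV: "X \<subseteq> V" "finite X" using sideD(1)[OF X(1)] finite_V finite_subset by auto
    have "\<not> card V < 3 * card (V - X)"
    proof
      assume big: "card V < 3 * card (V - X)"
      show False
      proof (cases "card V < 3 * card X")
        \<comment> \<open>The heavy side \<open>X\<close> contains \<open>P\<close> and
          \<open>Q\<close>, so \<open>P\<close>, \<open>Q\<close> and \<open>V - X\<close> would be
          three disjoint sets, each above a third.\<close>
        case True
        then have hX: "heavy X" using X big by (auto simp: heavy_def)
        have "P \<subseteq> X" "Q \<subseteq> X"
          using heavy_min_subset[OF P(1,3) hX X(2) uv(2)] heavy_min_subset[OF Q(1,3) hX X(3) w(1)] by auto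
        then have "card (P \<union> Q) \<le> card X" using XV by (intro card_mono) auto
        moreover have "card (P \<union> Q) = card P + card Q" using fin P Q by (intro card_Un_disjoint) auto
        moreover have "card X + card (V - X) = card V" using card_Diff_side[OF X(1)] by auto
        ultimately show False using P(1) Q(1) big by (auto simp: heavy_def)
      next
        case False
        have cP: "card V < 3 * card P" "card V < 3 * card (V - P)" using P(1) by (auto simp: heavy_def)
        \<comment> \<open>A light side \<open>X\<close> containing \<open>v\<close> also contains
          \<open>u\<close>, because \<open>f\<close> does not cross it. By laminarity it then
          includes \<open>P\<close> or \<open>V - P\<close>, both of which are too large.\<close>
        have "g \<noteq> f" using side_unique[OF X(1) _ X(2) uv(2)] f vw X(3) by auto
        then have "u \<in> X" using side_edge_in[OF X(1,2) f uv(1)] by blast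
        then have "\<not> X \<subseteq> P" "P \<inter> X \<noteq> {}" using uv X by auto
        then have "P \<subseteq> X \<or> V - P \<subseteq> X" using side_laminar[OF f X(1)] by blast
        then have "card P \<le> card X \<or> card (V - P) \<le> card X" using XV card_mono by blast
        then show False using cP False by auto
      qed
    qed
    then show "real (card (V - X)) \<le> ?n / 3" by linarith
  qed simp
  then have "disc v \<le> \<alpha> + ?n / 3" using stable[OF vw(1-3) ne] by linarith
  then have "?n * disc v \<le> ?n * (\<alpha> + ?n / 3)" by (intro mult_left_mono) auto
  moreover have "real (max_separation V E) \<le> ?n * disc v"
    using max_separation_le_disc[OF e A half] uv P by blast
  ultimately have up: "real (max_separation V E) \<le> ?n * \<alpha> + ?n * ?n / 3" by (simp add: algebra_simps)
  have M: "real (max_separation V E) = 2 * ?k * (?n - ?k)"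
    using e real_separation_side[OF A] by (simp add: max_sep_edges_def)
  \<comment> \<open>Because \<open>k\<close> lies between \<open>n / 3\<close> and
    \<open>2 * n / 3\<close>, the maximal separation is at least \<open>4 * n * n / 9\<close>. The
    term \<open>n * n / 3\<close> is then at most three quarters of it and can be absorbed.\<close>
  have "(3 * ?k - ?n) * (2 * ?n - 3 * ?k) \<ge> 0" using large half by (intro mult_nonneg_nonneg) linarith+
  then have "9 * (?k * (?n - ?k)) \<ge> 2 * (?n * ?n)" by (simp add: algebra_simps)
  then have "9 * real (max_separation V E) \<ge> 4 * (?n * ?n)" using M by simp
  then show ?thesis using up by (simp add: algebra_simps)
qed

theorem max_separation_bound:
  assumes n: "card V \<ge> 3" and "\<alpha> > 0"
    and stable: "\<And>v w. v \<in> V \<Longrightarrow> w \<in> V \<Longrightarrow> v \<noteq> w \<Longrightarrow> {v, w} \<notin> E \<Longrightarrow>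
      disc v \<le> \<alpha> + conn_graph.disc V (insert {v, w} E) v"
  shows "real (max_separation V E) \<le> 6 * \<alpha> * real (card V)"
proof (cases "max_separation V E > 0")
  case True
  have "V \<noteq> {}" "V \<noteq> {x}" for x using n by auto
  then obtain x where "x \<in> V" "V \<noteq> {x}" by blast
  then have "edge_cut E {x} \<noteq> {}" using cut_nonempty[of "{x}"] by auto
  then have "E \<noteq> {}" by (auto simp: edge_cut_def)
  then obtain e A where eA: "e \<in> max_sep_edges V E" "side e A" "2 * card A \<le> card V"
    using max_separation_side True by blast
  show ?thesis
  proof (cases "3 * card A \<le> card V")
    case True
    then show ?thesis using max_separation_bound_small[OF eA(1,2) True n stable] by blast
  next
    case False
    then show ?thesis using max_separation_bound_large[OF eA _ n stable] by simp
  qed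
qed (use assms in auto)

end

section \<open>The number of edges of a critical graph\<close>

context conn_graph
begin

text \<open>Every cut through \<open>e\<close> keeps at least two edges, so deleting
  \<open>e\<close> neither disconnects the graph nor creates a bridge. Sides are unchanged, hence so
  are relevances and separations.\<close>

lemma disc_remove_eq:
  assumes e: "e \<in> E"
    and two: "\<And>X. X \<subseteq> V \<Longrightarrow> e \<in> edge_cut E X \<Longrightarrow>
      \<exists>f g. f \<noteq> g \<and> f \<in> edge_cut (E - {e}) X \<and> g \<in> edge_cut (E - {e}) X"
  shows "conn_graph V (E - {e})"
    and "v \<in> V \<Longrightarrow> conn_graph.disc V (E - {e}) v = disc v"
proof -
  have cut_E: "edge_cut (E - {e}) X = edge_cut E X - {e}" for X by (auto simp: edge_cut_def)
  interpret N: finite_graph V "E - {e}" by (rule subgraph) auto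
  have "connected_graph V (E - {e})"
    unfolding N.connected_graph_iff_cut
  proof (intro allI impI)
    fix X assume X: "X \<subseteq> V" "X \<noteq> {}" "X \<noteq> V"
    show "edge_cut (E - {e}) X \<noteq> {}"
    proof (cases "e \<in> edge_cut E X")
      case True
      then show ?thesis using two[OF X(1)] by blast
    next
      case False
      then show ?thesis using cut_nonempty[OF X] cut_E by auto
    qed
  qed
  then show N': "conn_graph V (E - {e})" by unfold_locales
  then interpret N: conn_graph V "E - {e}" .
  assume v: "v \<in> V"
  have not_side: "e \<notin> edge_cut E X" if "X \<subseteq> V" "edge_cut E X - {e} \<subseteq> {g}" for X g
  proof
    assume "e \<in> edge_cut E X"
    from two[OF that(1) this] that(2) show False unfolding cut_E by blast
  qed
  have side_eq: "N.side g X \<longleftrightarrow> side g X" for g X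
  proof
    assume X: "N.side g X"
    then have "e \<notin> edge_cut E X" using not_side[of X g] by (simp add: N.side_def cut_E)
    then show "side g X" using X by (simp add: N.side_def side_def cut_E)
  next
    assume X: "side g X"
    then have "e \<notin> edge_cut E X" using not_side[of X g] by (auto simp: side_def)
    then show "N.side g X" using X by (simp add: N.side_def side_def cut_E)
  qed
  have rel: "relevance V (E - {e}) g x = relevance V E g x" if x: "x \<in> V" for g x
  proof (cases "\<exists>X. side g X \<and> x \<in> X")
    case True
    then obtain X where X: "side g X" "x \<in> X" by blast
    show ?thesis
      using relevance_side[OF X] N.relevance_side[of g X x] X side_eq by simp
  next
    case False
    then have "\<not> relevance V E g x > 0" "\<not> relevance V (E - {e}) g x > 0"
      using relevance_pos[OF _ x] N.relevance_pos[OF _ x] side_eq by metis+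
    then show ?thesis by simp
  qed
  then have sep: "separation V (E - {e}) g = separation V E g" for g
    by (simp add: separation_def)
  have sep_e: "separation V E e = 0"
  proof (rule ccontr)
    assume "separation V E e \<noteq> 0"
    then obtain X where "side e X" using separation_pos_side by blast
    then show False using not_side[of X e] by (auto simp: side_def)
  qed
  show "N.disc v = disc v"
  \<comment> \<open>If the maximum is \<open>0\<close>, then \<open>e\<close> itself counts as
    critical and the set of critical edges changes, but all costs vanish. Otherwise \<open>e\<close>
    is not critical and the set stays the same.\<close>
  proof (cases "max_separation V E = 0")
    case True
    have "relevance V E g v = 0" if "g \<in> E" for g
      using separation_le_max[OF that] True finite_V v by (simp add: separation_def)
    then have "N.disc v = 0" "disc v = 0"
      unfolding N.disc_def disc_def using rel[OF v] by (simp_all add: max_sep_edges_def)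
    then show ?thesis by simp
  next
    case False
    obtain g where g: "g \<in> max_sep_edges V E" using max_sep_edges_nonempty e by auto
    then have ge: "g \<in> E - {e}" "separation V E g = max_separation V E"
      using sep_e False by (auto simp: max_sep_edges_def)
    have "max_separation V (E - {e}) = max_separation V E"
    proof (rule antisym)
      show "max_separation V E \<le> max_separation V (E - {e})"
        using N.separation_le_max[OF ge(1)] sep ge(2) by simp
      have "\<And>h. h \<in> E - {e} \<Longrightarrow> separation V (E - {e}) h \<le> max_separation V E"
        using separation_le_max sep by simp
      then show "max_separation V (E - {e}) \<le> max_separation V E"
        unfolding max_separation_def[of V "E - {e}"] using ge(1) N.finite_E by (subst Max_le_iff) auto
    qed
    then have "max_sep_edges V (E - {e}) = max_sep_edges V E"
      using sep sep_e False by (auto simp: max_sep_edges_def)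
    then show ?thesis unfolding N.disc_def disc_def using rel[OF v] by simp
  qed
qed

theorem card_edges_le:
  assumes critical: "\<And>e. e \<in> E \<Longrightarrow> conn_graph V (E - {e}) \<Longrightarrow>
    \<exists>v\<in>V. disc v < conn_graph.disc V (E - {e}) v"
  shows "card E \<le> 2 * card V"
proof -
  obtain F1 where F1: "F1 \<subseteq> E" "card F1 \<le> card V" "\<And>X. X \<subseteq> V \<Longrightarrow> edge_cut F1 X = {} \<Longrightarrow> edge_cut E X = {}"
    using edge_cut_certificate by metis
  interpret D: finite_graph V "E - F1" by (rule subgraph) auto
  obtain F2 where F2: "F2 \<subseteq> E - F1" "card F2 \<le> card V"
    "\<And>X. X \<subseteq> V \<Longrightarrow> edge_cut F2 X = {} \<Longrightarrow> edge_cut (E - F1) X = {}"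
    using D.edge_cut_certificate by metis
  have "E \<subseteq> F1 \<union> F2"
  proof (rule ccontr)
    assume "\<not> E \<subseteq> F1 \<union> F2"
    then obtain e where e: "e \<in> E" "e \<notin> F1" "e \<notin> F2" by blast
    have two: "\<exists>f g. f \<noteq> g \<and> f \<in> edge_cut (E - {e}) X \<and> g \<in> edge_cut (E - {e}) X"
      if X: "X \<subseteq> V" "e \<in> edge_cut E X" for X
    proof -
      \<comment> \<open>As \<open>e\<close> itself survives the removal of \<open>F1\<close>, the
        cut is nonempty in both \<open>E\<close> and \<open>E - F1\<close>. The disjoint sets
        \<open>F1\<close> and \<open>F2\<close> thus each supply an edge of it.\<close>
      have "e \<in> edge_cut (E - F1) X" using X e by (simp add: edge_cut_def)
      then obtain f g where fg: "f \<in> edge_cut F1 X" "g \<in> edge_cut F2 X"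
        using F1(3)[OF X(1)] F2(3)[OF X(1)] X(2) by blast
      have "F1 \<subseteq> E - {e}" "F2 \<subseteq> E - {e}" using F1 F2 e by auto
      then have "f \<in> edge_cut (E - {e}) X" "g \<in> edge_cut (E - {e}) X"
        using fg edge_cut_mono by blast+
      moreover have "f \<noteq> g" using fg F2(1) by (auto simp: edge_cut_def)
      ultimately show ?thesis by blast
    qed
    show False using disc_remove_eq[OF e(1) two] critical[OF e(1)] by auto
  qed
  then have "card E \<le> card (F1 \<union> F2)" using finite_E F1(1) F2(1) by (intro card_mono) (auto intro: finite_subset)
  also have "\<dots> \<le> card F1 + card F2" by (rule card_Un_le)
  finally show ?thesis using F1(2) F2(2) by simp
qed

end

section \<open>Equilibria of the network formation game\<close>

lemma strategy_profileD:
  assumes "strategy_profile n S"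
  shows "S v w = 0 \<or> S v w = 1" "S v v = 0" "S v w = 1 \<Longrightarrow> v \<in> players n \<and> w \<in> players n"
proof -
  show "S v w = 0 \<or> S v w = 1" "S v v = 0" using assms unfolding strategy_profile_def by blast+
  show "S v w = 1 \<Longrightarrow> v \<in> players n \<and> w \<in> players n"
    using assms unfolding strategy_profile_def by (metis zero_neq_one)
qed

lemma finite_players [simp]: "finite (players n)" and card_players [simp]: "card (players n) = n"
  by (simp_all add: players_def)

lemma final_edges_iff:
  assumes "strategy_profile n S"
  shows "{v, w} \<in> final_edges n S \<longleftrightarrow> S v w = 1 \<or> S w v = 1"
  using strategy_profileD(3)[OF assms] unfolding final_edges_def by (auto simp: doubleton_eq_iff)

lemma final_edges_eq:
  assumes "strategy_profile n S"
  shows "final_edges n S = (\<lambda>(v, w). {v, w}) ` {(v, w). S v w = 1}"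
  using strategy_profileD(3)[OF assms] unfolding final_edges_def by (auto simp: image_iff insert_commute)

lemma finite_graph_final_edges:
  assumes "strategy_profile n S"
  shows "finite_graph (players n) (final_edges n S)"
proof
  fix e assume "e \<in> final_edges n S"
  then obtain v w where e: "e = {v, w}" "S v w = 1" unfolding final_edges_eq[OF assms] by auto
  then have "v \<noteq> w" using strategy_profileD(2)[OF assms] by auto
  then show "e \<subseteq> players n \<and> card e = 2" using e strategy_profileD(3)[OF assms] by auto
qed simp

lemma sum_strategy_eq_card:
  assumes "strategy_profile n S"
  shows "(\<Sum>v\<in>players n. \<Sum>w\<in>players n. real (S v w)) = real (card {(v, w). S v w = 1})"
proof -
  let ?V = "players n" and ?A = "{(v, w). S v w = 1}"
  have A: "?A \<subseteq> ?V \<times> ?V" using strategy_profileD(3)[OF assms] by auto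
  have "(\<Sum>v\<in>?V. \<Sum>w\<in>?V. real (S v w)) = (\<Sum>p\<in>?V \<times> ?V. if p \<in> ?A then 1 else 0)"
    unfolding sum.cartesian_product
    using strategy_profileD(1)[OF assms] by (intro sum.cong) (auto, metis One_nat_def)
  also have "\<dots> = (\<Sum>p\<in>(?V \<times> ?V) \<inter> ?A. 1)"
    by (rule sum.inter_restrict[symmetric]) simp
  also have "(?V \<times> ?V) \<inter> ?A = ?A" using A by blast
  finally show ?thesis by simp
qed

text \<open>In an essential profile no edge is requested from both ends, so requests correspond
  one-to-one to edges.\<close>

lemma sum_strategy_eq_card_edges:
  assumes S: "strategy_profile n S" "essential n S"
  shows "(\<Sum>v\<in>players n. \<Sum>w\<in>players n. real (S v w)) = real (card (final_edges n S))"
proof -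
  have "inj_on (\<lambda>(v, w). {v, w}) {(v, w). S v w = 1}"
  proof (rule inj_onI, clarify)
    fix a b c d assume h: "S a b = 1" "S c d = 1" "{a, b} = {c, d}"
    then have "S b a \<noteq> 1"
      using S strategy_profileD(3)[OF S(1) h(1)] by (auto simp: essential_def)
    with h show "a = c \<and> b = d" by (auto simp: doubleton_eq_iff)
  qed
  then show ?thesis
    unfolding sum_strategy_eq_card[OF S(1)] final_edges_eq[OF S(1)] by (simp add: card_image)
qed

section \<open>Social cost and the lower bound for the optimum\<close>

lemma disconnection_cost_nonneg: "disconnection_cost V E v \<ge> 0"
  unfolding disconnection_cost_def by (auto intro!: divide_nonneg_nonneg sum_nonneg)

lemma social_cost_eq:
  assumes "conn_graph (players n) (final_edges n S)" "final_edges n S \<noteq> {}"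
  shows "social_cost n \<alpha> S = ereal (\<alpha> * (\<Sum>v\<in>players n. \<Sum>w\<in>players n. real (S v w)) +
    real (max_separation (players n) (final_edges n S)))"
proof -
  interpret conn_graph "players n" "final_edges n S" by fact
  have "social_cost n \<alpha> S =
    ereal (\<Sum>v\<in>players n. \<alpha> * (\<Sum>w\<in>players n. real (S v w)) + disc v)"
    unfolding social_cost_def individual_cost_def disconnection_cost_eq by simp
  then show ?thesis
    unfolding sum.distrib sum_disc[OF assms(2)] by (simp add: sum_distrib_left)
qed

lemma connected_degree_pos:
  assumes "strategy_profile n S" "connected_graph (players n) (final_edges n S)" "n \<ge> 2" "v \<in> players n"
  shows "\<exists>w\<in>players n. S v w = 1 \<or> S w v = 1"
proof -
  interpret finite_graph "players n" "final_edges n S" using finite_graph_final_edges[OF assms(1)] .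
  have "card {v} \<noteq> card (players n)" using assms(3) by simp
  then have "{v} \<noteq> players n" by metis
  then have "edge_cut (final_edges n S) {v} \<noteq> {}"
    using assms(2,4) connected_graph_iff_cut by simp
  then obtain e where "e \<in> edge_cut (final_edges n S) {v}" by blast
  then obtain x y where "e = {x, y}" "x = v" "y \<in> players n" "e \<in> final_edges n S"
    by (rule edge_cutE) auto
  then show ?thesis using final_edges_iff[OF assms(1), of v y] by auto
qed

text \<open>A disconnected graph costs infinity. Otherwise every player makes or receives a request,
  and each request is counted for two players. Counting requests instead of edges covers profiles
  that are not essential.\<close>

lemma social_cost_ge:
  assumes S: "strategy_profile n S" and n: "n \<ge> 2" and a: "\<alpha> \<ge> 0"
  shows "ereal (\<alpha> * (real n / 2)) \<le> social_cost n \<alpha> S"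
proof (cases "connected_graph (players n) (final_edges n S)")
  case False
  have "1 \<in> players n" using n by (simp add: players_def)
  have nonneg: "0 \<le> individual_cost n \<alpha> S v" for v
    unfolding individual_cost_def using a disconnection_cost_nonneg by (auto intro!: add_nonneg_nonneg mult_nonneg_nonneg sum_nonneg)
  have "individual_cost n \<alpha> S 1 \<le> social_cost n \<alpha> S"
    unfolding social_cost_def using \<open>1 \<in> players n\<close> nonneg
    sum_mono2[of "players n" "{1}" "individual_cost n \<alpha> S"] by simp
  moreover have "individual_cost n \<alpha> S 1 = \<infinity>"
    using False by (simp add: individual_cost_def disconnection_cost_def)
  ultimately show ?thesis by simp
next
  case True
  let ?V = "players n" and ?s = "\<Sum>v\<in>players n. \<Sum>w\<in>players n. real (S v w)"
  have "1 \<le> (\<Sum>w\<in>?V. real (S v w) + real (S w v))" if v: "v \<in> ?V" for v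
  proof -
    obtain w where w: "w \<in> ?V" "S v w = 1 \<or> S w v = 1" using connected_degree_pos[OF S True n v] by blast
    have "1 \<le> real (S v w) + real (S w v)" using w(2) by auto
    also have "\<dots> \<le> (\<Sum>w\<in>?V. real (S v w) + real (S w v))" using w(1) by (intro member_le_sum) auto
    finally show ?thesis .
  qed
  then have "(\<Sum>v\<in>?V. 1) \<le> (\<Sum>v\<in>?V. \<Sum>w\<in>?V. real (S v w) + real (S w v))" by (intro sum_mono)
  also have "\<dots> = ?s + (\<Sum>v\<in>?V. \<Sum>w\<in>?V. real (S w v))" by (simp add: sum.distrib)
  also have "(\<Sum>v\<in>?V. \<Sum>w\<in>?V. real (S w v)) = ?s" by (rule sum.swap)
  finally have "real n / 2 \<le> ?s" by simp
  then have "\<alpha> * (real n / 2) \<le> \<alpha> * ?s" using a by (rule mult_left_mono)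
  then have "ereal (\<alpha> * (real n / 2)) \<le> ereal (\<alpha> * ?s)" by simp
  also have "\<dots> = (\<Sum>v\<in>?V. ereal (\<alpha> * (\<Sum>w\<in>?V. real (S v w))))" by (simp add: sum_distrib_left)
  also have "\<dots> \<le> social_cost n \<alpha> S"
    unfolding social_cost_def individual_cost_def
  proof (rule sum_mono)
    show "x \<le> x + disconnection_cost ?V (final_edges n S) v" for x v
      using add_left_mono[OF disconnection_cost_nonneg, of x ?V _ v] by simp
  qed
  finally show ?thesis .
qed

lemma OPT_ge: "n \<ge> 2 \<Longrightarrow> \<alpha> \<ge> 0 \<Longrightarrow> ereal (\<alpha> * (real n / 2)) \<le> OPT n \<alpha>"
  unfolding OPT_def using finite_strategy_profiles strategy_profiles_nonempty social_cost_ge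
  by (subst Min_ge_iff) auto

section \<open>Single-entry deviations and the conditions they impose\<close>

lemma strategy_profile_upd:
  assumes "strategy_profile n S" "v \<in> players n" "w \<in> players n" "v \<noteq> w" "b \<in> {0, 1}"
  shows "strategy_profile n (S(v := (S v)(w := b)))"
  using assms unfolding strategy_profile_def by auto

lemma sum_upd:
  fixes S :: "nat \<Rightarrow> nat \<Rightarrow> nat"
  assumes "w \<in> players n"
  shows "(\<Sum>x\<in>players n. real (((S v)(w := b)) x)) =
    (\<Sum>x\<in>players n. real (S v x)) - real (S v w) + real b"
  using assms by (simp add: sum.remove[OF finite_players assms])

lemma final_edges_add:
  assumes "v \<in> players n" "w \<in> players n"
  shows "final_edges n (S(v := (S v)(w := 1))) = insert {v, w} (final_edges n S)"
  using assms unfolding final_edges_def by (auto simp: doubleton_eq_iff)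

text \<open>Withdrawing the request of \<open>v\<close> deletes the edge because \<open>w\<close>
  does not request it as well.\<close>

lemma final_edges_remove:
  assumes "v \<noteq> w" "S w v = 0"
  shows "final_edges n (S(v := (S v)(w := 0))) = final_edges n S - {{v, w}}"
proof -
  let ?T = "S(v := (S v)(w := 0))"
  have "?T x y = 1 \<or> ?T y x = 1 \<longleftrightarrow> (S x y = 1 \<or> S y x = 1) \<and> {x, y} \<noteq> {v, w}" for x y
    using assms by (auto simp: doubleton_eq_iff)
  then have "final_edges n ?T = {{x, y} | x y. x \<in> players n \<and> y \<in> players n \<and>
      ((S x y = 1 \<or> S y x = 1) \<and> {x, y} \<noteq> {v, w})}"
    unfolding final_edges_def by presburger
  also have "\<dots> = final_edges n S - {{v, w}}" unfolding final_edges_def by auto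
  finally show ?thesis .
qed

text \<open>In a disconnected graph player \<open>1\<close> has infinite cost, while linking to
  everybody connects the graph at finite cost.\<close>

lemma nash_connected:
  assumes N: "nash_equilibrium n \<alpha> S" and n: "n \<ge> 1"
  shows "conn_graph (players n) (final_edges n S)"
proof -
  have S: "strategy_profile n S" using N by (simp add: nash_equilibrium_def)
  interpret finite_graph "players n" "final_edges n S" using finite_graph_final_edges[OF S] .
  let ?v = "1::nat"
  define r where "r = (\<lambda>w. if w \<in> players n \<and> w \<noteq> ?v then 1 else 0 :: nat)"
  let ?S = "S(?v := r)"
  have v: "?v \<in> players n" using n by (simp add: players_def)
  have S': "strategy_profile n ?S" using S v unfolding strategy_profile_def r_def by auto
  interpret D: finite_graph "players n" "final_edges n ?S" using finite_graph_final_edges[OF S'] .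
  have "connected_graph (players n) (final_edges n ?S)"
    unfolding D.connected_graph_iff_cut
  proof (intro allI impI)
    fix X assume X: "X \<subseteq> players n" "X \<noteq> {}" "X \<noteq> players n"
    obtain x where x: "x \<in> players n" "x \<in> X \<longleftrightarrow> ?v \<notin> X" using X by blast
    then have "x \<noteq> ?v" by auto
    then have "{?v, x} \<in> final_edges n ?S" using final_edges_iff[OF S'] x by (simp add: r_def)
    then have "{?v, x} \<in> edge_cut (final_edges n ?S) X" using x by (auto simp: edge_cut_def)
    then show "edge_cut (final_edges n ?S) X \<noteq> {}" by blast
  qed
  then have fin: "individual_cost n \<alpha> ?S ?v < \<infinity>"
    by (simp add: individual_cost_def disconnection_cost_def)
  have "connected_graph (players n) (final_edges n S)"
  proof (rule ccontr)
    assume "\<not> connected_graph (players n) (final_edges n S)"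
    then have "individual_cost n \<alpha> S ?v = \<infinity>"
      by (simp add: individual_cost_def disconnection_cost_def)
    then show False using N fin v S' unfolding nash_equilibrium_def by metis
  qed
  then show ?thesis by unfold_locales
qed

text \<open>Treats buying (\<open>b = 1\<close>) and selling (\<open>b = 0\<close>) a link at once.
  With both graphs connected the costs are finite, so the equilibrium condition becomes an
  inequality of reals.\<close>

lemma nash_disc:
  assumes N: "nash_equilibrium n \<alpha> S" and C: "conn_graph (players n) (final_edges n S)"
    and vw: "v \<in> players n" "w \<in> players n" "v \<noteq> w" "b \<in> {0, 1}"
    and C': "conn_graph (players n) (final_edges n (S(v := (S v)(w := b))))"
  shows "conn_graph.disc (players n) (final_edges n S) v \<le> \<alpha> * (real b - real (S v w)) +
    conn_graph.disc (players n) (final_edges n (S(v := (S v)(w := b)))) v"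
proof -
  let ?S = "S(v := (S v)(w := b))"
  have S: "strategy_profile n S" using N by (simp add: nash_equilibrium_def)
  have "\<not> individual_cost n \<alpha> ?S v < individual_cost n \<alpha> S v"
    using N strategy_profile_upd[OF S vw] vw(1) by (simp add: nash_equilibrium_def)
  moreover have "individual_cost n \<alpha> ?S v = ereal (\<alpha> * ((\<Sum>x\<in>players n. real (S v x)) - real (S v w) + real b)
      + conn_graph.disc (players n) (final_edges n ?S) v)"
    unfolding individual_cost_def conn_graph.disconnection_cost_eq[OF C'] fun_upd_same sum_upd[OF vw(2)]
    by simp
  moreover have "individual_cost n \<alpha> S v = ereal (\<alpha> * (\<Sum>x\<in>players n. real (S v x))
      + conn_graph.disc (players n) (final_edges n S) v)"
    unfolding individual_cost_def conn_graph.disconnection_cost_eq[OF C] by simp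
  ultimately show ?thesis by (simp add: algebra_simps)
qed

text \<open>The factor \<open>8\<close> is \<open>2\<close> from the bound on the number of links
  plus \<open>6\<close> from the bound on the maximal separation.\<close>

lemma nash_social_cost_le:
  assumes n: "n \<ge> 3" and a: "\<alpha> > 0" and ess: "essential n S" and N: "nash_equilibrium n \<alpha> S"
  shows "social_cost n \<alpha> S \<le> ereal (8 * \<alpha> * real n)"
proof -
  let ?V = "players n" and ?E = "final_edges n S"
  have S: "strategy_profile n S" using N by (simp add: nash_equilibrium_def)
  have C: "conn_graph ?V ?E" using nash_connected[OF N] n by simp
  interpret conn_graph ?V ?E by (rule C)
  have "disc v \<le> \<alpha> + conn_graph.disc ?V (insert {v, w} ?E) v"
    if vw: "v \<in> ?V" "w \<in> ?V" "v \<noteq> w" "{v, w} \<notin> ?E" for v w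
  proof -
    have "S v w = 0" using vw(4) final_edges_iff[OF S] strategy_profileD(1)[OF S, of v w] by blast
    then show ?thesis
      using nash_disc[OF N C vw(1-3), of 1] conn_graph_insert[OF vw(1-3)] final_edges_add[OF vw(1,2)] by simp
  qed
  then have sep: "real (max_separation ?V ?E) \<le> 6 * \<alpha> * real n"
    using max_separation_bound[of \<alpha>] n a by simp
  have "card ?E \<le> 2 * card ?V"
  proof (rule card_edges_le)
    fix e assume e: "e \<in> ?E" "conn_graph ?V (?E - {e})"
    then obtain v w where vw: "e = {v, w}" "S v w = 1" unfolding final_edges_eq[OF S] by auto
    have V: "v \<in> ?V" "w \<in> ?V" "v \<noteq> w"
      using strategy_profileD(3)[OF S vw(2)] strategy_profileD(2)[OF S] vw(2) by auto
    have "S w v = 0" using ess V vw(2) by (simp add: essential_def)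
    then have "final_edges n (S(v := (S v)(w := 0))) = ?E - {e}"
      using final_edges_remove[of v w S n] V(3) vw(1) by simp
    \<comment> \<open>The buyer \<open>v\<close> would save \<alpha> by selling. As \<alpha> is
      positive, stability makes her disconnection cost strictly larger without
      \<open>e\<close>.\<close>
    then have "disc v < conn_graph.disc ?V (?E - {e}) v"
      using nash_disc[OF N C V, of 0] e(2) vw(2) a by simp
    then show "\<exists>v\<in>?V. disc v < conn_graph.disc ?V (?E - {e}) v" using V(1) by blast
  qed
  then have "\<alpha> * real (card ?E) \<le> \<alpha> * (2 * real n)" using a by (intro mult_left_mono) auto
  moreover have "?E \<noteq> {}"
    using connected_degree_pos[OF S conn, of 1] n final_edges_iff[OF S] by (auto simp: players_def)
  ultimately show ?thesis
    using sep social_cost_eq[OF C] sum_strategy_eq_card_edges[OF S ess] by simp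
qed

theorem theorem9p8:
  "\<exists>c::real. c > 0 \<and>
     (\<forall>(n::nat) (\<alpha>::real) S. n \<ge> 3 \<longrightarrow> \<alpha> > 0 \<longrightarrow> essential n S \<longrightarrow> nash_equilibrium n \<alpha> S \<longrightarrow>
        social_cost n \<alpha> S \<le> ereal c * OPT n \<alpha>)"
proof (intro exI[of _ 16] conjI allI impI)
  fix n \<alpha> S
  assume h: "(n::nat) \<ge> 3" "(\<alpha>::real) > 0" "essential n S" "nash_equilibrium n \<alpha> S"
  \<comment> \<open>The constant \<open>16\<close> is the quotient of
    \<open>8 * \<alpha> * n\<close> and the lower bound \<open>\<alpha> * n / 2\<close> for the
    optimum.\<close>
  have "social_cost n \<alpha> S \<le> ereal 16 * ereal (\<alpha> * (real n / 2))"
    using nash_social_cost_le[OF h] by (simp add: mult_ac)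
  also have "\<dots> \<le> ereal 16 * OPT n \<alpha>"
    using OPT_ge[of n \<alpha>] h by (intro ereal_mult_left_mono) auto
  finally show "social_cost n \<alpha> S \<le> ereal 16 * OPT n \<alpha>" .
qed simp

end
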